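(* Let $U:\mathbb{S}^2\to\mathbb{S}^2$ be a homeomorphism. The deformed field $T^U(\mathbf{x})=T(U(\mathbf{x}))$, $\mathbf{x}\in\mathbb{S}^2$, is isotropic for every isotropic spherical random field $T$ if and only if $U$ is an isometry of the sphere.
   Context: $\mathbb{S}^2$ is the unit sphere in $\mathbb{R}^3$ with the great-circle (angular) distance $\gamma$; isometry means with respect to $\gamma$. Standing assumptions: a spherical random field is a real-valued second-order random field $T$ on $\mathbb{S}^2$ with zero mean whose covariance function $C(\mathbf{x}_1,\mathbf{x}_2)=\mathbf{E}(T(\mathbf{x}_1)T(\mathbf{x}_2))$ is continuous on $\mathbb{S}^2\times\mathbb{S}^2$ and not identically constant. It is isotropic if $C(\mathbf{x}_1,\mathbf{x}_2)=B(\gamma(\mathbf{x}_1,\mathbf{x}_2))$ for some $B:[0,\pi]\to\mathbb{R}$ and all $\mathbf{x}_1,\mathbf{x}_2\in\mathbb{S}^2$. *)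

theory Defs
  imports "HOL-Probability.Probability"
begin

abbreviation S2 :: "(real^3) set" where
  "S2 \<equiv> sphere 0 1"

text \<open>Great-circle distance; only meaningful for points of the unit sphere.\<close>

definition angular_dist :: "real^3 \<Rightarrow> real^3 \<Rightarrow> real" where
  "angular_dist x y = arccos (x \<bullet> y)"

definition sphere_isometry :: "(real^3 \<Rightarrow> real^3) \<Rightarrow> bool" where
  "sphere_isometry U \<longleftrightarrow> U ` S2 = S2 \<and>
     (\<forall>x\<in>S2. \<forall>y\<in>S2. angular_dist (U x) (U y) = angular_dist x y)"

text \<open>
  A field is a total function on the ambient space; only its values at points of the
  sphere matter in the definitions below.
\<close>

definition covariance :: "'w measure \<Rightarrow> (real^3 \<Rightarrow> 'w \<Rightarrow> real) \<Rightarrow> real^3 \<Rightarrow> real^3 \<Rightarrow> real" where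
  "covariance M T x y = (\<integral>\<omega>. T x \<omega> * T y \<omega> \<partial>M)"
  \<comment> \<open>used only for fields of mean zero, hence no centring\<close>

locale spherical_random_field = prob_space M
  for M :: "'w measure" and T :: "real^3 \<Rightarrow> 'w \<Rightarrow> real" +
  assumes measurable: "x \<in> S2 \<Longrightarrow> random_variable borel (T x)"
    and second_order: "x \<in> S2 \<Longrightarrow> integrable M (\<lambda>\<omega>. (T x \<omega>)\<^sup>2)"
    and zero_mean: "x \<in> S2 \<Longrightarrow> expectation (T x) = 0"
    and continuous_covariance: "continuous_on (S2 \<times> S2) (\<lambda>(x, y). covariance M T x y)"
    and nonconstant_covariance: "\<not> (\<lambda>(x, y). covariance M T x y) constant_on S2 \<times> S2"

text \<open>
  The angular distance takes its values in the interval from \<open>0\<close> to \<open>pi\<close> on the sphere, so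
  the values of \<open>B\<close> elsewhere are irrelevant.
\<close>

definition isotropic_spherical_random_field ::
    "'w measure \<Rightarrow> (real^3 \<Rightarrow> 'w \<Rightarrow> real) \<Rightarrow> bool" where
  "isotropic_spherical_random_field M T \<longleftrightarrow> spherical_random_field M T \<and>
     (\<exists>B :: real \<Rightarrow> real. \<forall>x\<in>S2. \<forall>y\<in>S2. covariance M T x y = B (angular_dist x y))"

definition deformed_field ::
    "(real^3 \<Rightarrow> real^3) \<Rightarrow> (real^3 \<Rightarrow> 'w \<Rightarrow> real) \<Rightarrow> real^3 \<Rightarrow> 'w \<Rightarrow> real" where
  "deformed_field U T = (\<lambda>x. T (U x))"

text \<open>
  HOL cannot quantify over all types inside a formula, so a statement about every isotropic
  field refers to the probability spaces over one type \<open>'w\<close> of outcomes. That type is to be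
  left arbitrary but infinite: over a type with a single outcome, for instance, a field of
  mean zero vanishes almost surely, so there is no spherical random field at all and such a
  statement is vacuous. The path space \<open>real^3 \<Rightarrow> real\<close> is one admissible instance, and it
  carries a copy of every field on any probability space, with the same finite-dimensional
  distributions on the sphere.
\<close>

end

theory Submission
  imports Defs
begin

text \<open>
  A field whose covariance is the inner product shows that \<open>U x \<bullet> U y = g (x \<bullet> y)\<close> for some
  function \<open>g\<close>. As \<open>U\<close> is a bijection, it preserves antipodes: the points at a given angle from
  \<open>x\<close> different from \<open>0\<close> and \<open>pi\<close> are not unique, the antipode of \<open>U x\<close> is. Hence \<open>g\<close> is odd,
  \<open>g 0 = 0\<close>, and \<open>U\<close> maps the standard basis to an orthonormal basis. Expanding in this basis,
  \<open>g (x \<bullet> y)\<close> is the sum of the products \<open>g (x $ i) * g (y $ i)\<close>. For \<open>x = y\<close> this makes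
  \<open>s \<mapsto> (g (sqrt s))\<^sup>2\<close> additive on the unit interval, so \<open>(g t)\<^sup>2 = t\<^sup>2\<close>; the choice
  \<open>x = (a, 0, c)\<close>, \<open>y = (a, 0, -c)\<close> then gives \<open>g t = t\<close>.
\<close>

section \<open>Orthonormal expansion and Cauchy's functional equation\<close>

text \<open>The matrix with rows \<open>u i\<close> is orthogonal, hence preserves inner products,
  and it sends \<open>x\<close> to the vector of the \<open>x \<bullet> u i\<close>.\<close>

lemma inner_orthonormal_expansion:
  fixes u :: "'n::finite \<Rightarrow> real^'n"
  assumes "\<And>i j. u i \<bullet> u j = (if i = j then 1 else 0)"
  shows "x \<bullet> y = (\<Sum>i\<in>UNIV. (x \<bullet> u i) * (y \<bullet> u i))"
proof -
  define Q :: "real^'n^'n" where "Q = (\<chi> i. u i)"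
  have "orthogonal_matrix Q"
    unfolding orthogonal_matrix_orthonormal_rows
    using assms by (auto simp: Q_def row_def norm_eq_1 orthogonal_def vec_nth_inverse)
  then have "orthogonal_transformation ((*v) Q)"
    by (simp add: orthogonal_transformation_matrix matrix_vector_mul_linear)
  then have "x \<bullet> y = (Q *v x) \<bullet> (Q *v y)"
    by (simp add: orthogonal_transformation_def)
  also have "\<dots> = (\<Sum>i\<in>UNIV. (x \<bullet> u i) * (y \<bullet> u i))"
    by (simp add: inner_vec_def matrix_vector_mult_def Q_def mult.commute)
  finally show ?thesis .
qed

text \<open>Additivity forces \<open>h\<close> to be the identity at multiples of
  \<open>1 / n\<close>. Nonnegativity makes \<open>h\<close> monotone, so \<open>x\<close> and
  \<open>h x\<close> lie between the same two neighbouring multiples, for every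
  \<open>n\<close>.\<close>

lemma additive_on_unit_interval_eq_id:
  fixes h :: "real \<Rightarrow> real"
  assumes add: "\<And>a b. 0 \<le> a \<Longrightarrow> 0 \<le> b \<Longrightarrow> a + b \<le> 1 \<Longrightarrow> h (a + b) = h a + h b"
    and nonneg: "\<And>a. 0 \<le> a \<Longrightarrow> a \<le> 1 \<Longrightarrow> 0 \<le> h a"
    and one: "h 1 = 1"
    and x: "0 \<le> x" "x \<le> 1"
  shows "h x = x"
proof -
  have zero: "h 0 = 0"
    using add[of 0 0] by simp
  have mult: "real k * s \<le> 1 \<Longrightarrow> h (real k * s) = real k * h s" if "0 \<le> s" for k s
  proof (induction k)
    case 0
    then show ?case by (simp add: zero)
  next
    case (Suc k)
    then have "real k * s + s \<le> 1"
      by (simp add: algebra_simps)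
    with Suc.IH add[of "real k * s" s] that show ?case
      by (simp add: algebra_simps)
  qed
  have close: "\<bar>h x - x\<bar> \<le> 1 / real (Suc n)" for n
  proof -
    let ?s = "1 / real (Suc n)"
    \<comment> \<open>The largest multiple of \<open>?s\<close> not exceeding \<open>x\<close> is
      \<open>real k * ?s\<close>; \<open>r\<close> is the remainder.\<close>
    define k where "k = nat \<lfloor>real (Suc n) * x\<rfloor>"
    define r where "r = x - real k * ?s"
    have k: "real k \<le> real (Suc n) * x" "real (Suc n) * x < real k + 1"
      using x by (auto simp: k_def)
    have ks: "real k * ?s \<le> x" and xs: "x < real k * ?s + ?s"
      using k by (auto simp: field_simps)
    then have r: "0 \<le> r" "r \<le> ?s"
      by (auto simp: r_def)
    have s1: "?s \<le> 1" by simp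
    have hs: "h ?s = ?s"
      using mult[of ?s "Suc n"] one by (simp add: field_simps)
    have "h x = h (real k * ?s) + h r"
      using add[of "real k * ?s" r] x r by (simp add: r_def)
    also have "h (real k * ?s) = real k * ?s"
    proof -
      have "real k * ?s \<le> 1"
        using ks x(2) by (rule order_trans)
      then have "h (real k * ?s) = real k * h ?s"
        by (rule mult[rotated]) simp
      then show ?thesis by (simp only: hs)
    qed
    finally have "h x = real k * ?s + h r" .
    moreover have "0 \<le> h r"
      using nonneg[OF r(1) order_trans[OF r(2) s1]] .
    moreover have "h r \<le> ?s"
    proof -
      \<comment> \<open>Monotonicity in disguise: splitting \<open>?s\<close> at \<open>r\<close>
        leaves a nonnegative second summand.\<close>
      have "h ?s = h r + h (?s - r)"
        using add[of r "?s - r"] r s1 by simp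
      moreover have "0 \<le> h (?s - r)"
        by (rule nonneg) (use r s1 in linarith)+
      ultimately show ?thesis
        using hs by linarith
    qed
    ultimately show ?thesis
      using r unfolding r_def by linarith
  qed
  have "(\<lambda>n. 1 / real (Suc n)) \<longlonglongrightarrow> 0"
    using LIMSEQ_inverse_real_of_nat by (simp add: inverse_eq_divide)
  then have "\<bar>h x - x\<bar> \<le> 0"
    by (rule LIMSEQ_le_const) (use close in blast)
  then show ?thesis by simp
qed

section \<open>Bijections of the sphere whose inner products depend on the angle only\<close>

lemma unit_inner_eq_minus_one:
  fixes x y :: "'a::real_inner"
  assumes "norm x = 1" "norm y = 1" "x \<bullet> y = -1"
  shows "y = - x"
proof -
  have "norm (x + y) ^ 2 = 0"
    using assms by (simp add: power2_norm_eq_inner inner_add inner_commute norm_eq_1)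
  then show ?thesis
    by (simp add: add_eq_0_iff)
qed

lemma inner_dependent_bij_sphere_antipode:
  fixes U :: "'a::real_inner \<Rightarrow> 'a"
  assumes bij: "bij_betw U (sphere 0 1) (sphere 0 1)"
    and dep: "\<And>x y. x \<in> sphere 0 1 \<Longrightarrow> y \<in> sphere 0 1 \<Longrightarrow> U x \<bullet> U y = g (x \<bullet> y)"
    and x: "x \<in> sphere 0 1"
  shows "U (- x) = - U x"
proof -
  have Ux: "norm (U x) = 1"
    using bij_betwE[OF bij] x by simp
  then have "- U x \<in> U ` sphere 0 1"
    using bij by (simp add: bij_betw_def)
  then obtain y where y: "y \<in> sphere 0 1" "U y = - U x"
    by auto
  \<comment> \<open>The reflection of \<open>y\<close> in the line through \<open>x\<close>: again a
    unit vector, at the same angle from \<open>x\<close>. Thus \<open>U ?z\<close> is also the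
    antipode of \<open>U x\<close>, and injectivity puts \<open>y\<close> on that line.\<close>
  let ?z = "(2 * (x \<bullet> y)) *\<^sub>R x - y"
  have xx: "x \<bullet> x = 1" and yy: "y \<bullet> y = 1"
    using x y by (simp_all add: norm_eq_1)
  have z: "?z \<in> sphere 0 1"
    using xx yy by (simp add: norm_eq_1 inner_diff inner_commute algebra_simps)
  have xz: "x \<bullet> ?z = x \<bullet> y"
    using xx by (simp add: inner_diff)
  have Uy: "U x \<bullet> U y = -1"
    using y Ux by (simp add: norm_eq_1)
  moreover have "U x \<bullet> U ?z = U x \<bullet> U y"
    using dep x y z xz by metis
  ultimately have "U ?z = U y"
    using unit_inner_eq_minus_one[OF Ux, of "U ?z"] bij_betwE[OF bij] z y by simp
  then have "?z = y"
    using inj_onD[OF bij_betw_imp_inj_on[OF bij] _ z y(1)] by blast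
  then have "2 *\<^sub>R y = 2 *\<^sub>R ((x \<bullet> y) *\<^sub>R x)"
    by (simp add: algebra_simps scaleR_2)
  then have yx: "y = (x \<bullet> y) *\<^sub>R x"
    by (simp only: scaleR_cancel_left) simp
  have "(x \<bullet> y) * (x \<bullet> y) = 1"
    using yy xx by (subst (asm) yx, subst (asm) (2) yx) simp
  then have "x \<bullet> y = 1 \<or> x \<bullet> y = -1"
    by (simp add: square_eq_1_iff)
  moreover have "y \<noteq> x"
    using Uy Ux by (auto simp: norm_eq_1)
  ultimately have "y = - x"
    using yx by (metis scaleR_one scaleR_minus1_left)
  with y show ?thesis by simp
qed

text \<open>The task is to show that the unknown \<open>g\<close> is the identity on the interval
  from -1 to 1, which contains all inner products of unit vectors.\<close>

lemma inner_dependent_bij_S2_preserves_inner: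
  fixes U :: "real^3 \<Rightarrow> real^3"
  assumes bij: "bij_betw U S2 S2"
    and dep: "\<And>x y. x \<in> S2 \<Longrightarrow> y \<in> S2 \<Longrightarrow> U x \<bullet> U y = g (x \<bullet> y)"
    and xy: "x \<in> S2" "y \<in> S2"
  shows "U x \<bullet> U y = x \<bullet> y"
proof -
  let ?e = "\<lambda>i::3. axis i (1::real)"
  have e: "?e i \<in> S2" for i
    by simp
  have US: "U v \<bullet> U v = 1" if "v \<in> S2" for v
    using bij_betwE[OF bij] that by (simp add: norm_eq_1)
  have anti: "U (- v) = - U v" if "v \<in> S2" for v
    using inner_dependent_bij_sphere_antipode[OF bij dep that] .
  have odd: "g (- (v \<bullet> w)) = - g (v \<bullet> w)" if "v \<in> S2" "w \<in> S2" for v w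
    using dep[of v w] dep[of v "- w"] anti that by simp
  have coord: "U v \<bullet> U (?e i) = g (v $ i)" if "v \<in> S2" for v i
    using dep[OF that e] by (simp add: inner_axis)
  \<comment> \<open>Oddness at two orthogonal axes gives \<open>g 0 = - g 0\<close>.\<close>
  have g0: "g 0 = 0"
    using odd[OF e[of 1] e[of 2]] by (simp add: inner_axis_axis)
  have g1: "g 1 = 1"
    using dep[OF e e, of 1 1] US[OF e, of 1] by (simp add: inner_axis_axis)
  have "U (?e i) \<bullet> U (?e j) = (if i = j then 1 else 0)" for i j
    using dep[OF e e, of i j] g0 g1 by (simp add: inner_axis_axis)
  note Parseval = inner_orthonormal_expansion[where u = "\<lambda>i. U (?e i)", OF this]
  \<comment> \<open>By \<open>coord\<close>, the numbers \<open>g (v $ i)\<close> are the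
    coordinates of \<open>U v\<close> in the orthonormal basis of the
    \<open>U (?e i)\<close>.\<close>
  have expand: "g (v \<bullet> w) = (\<Sum>i\<in>UNIV. g (v $ i) * g (w $ i))"
    if "v \<in> S2" "w \<in> S2" for v w
    using dep[OF that] Parseval[of "U v" "U w"] by (simp only: coord that)
  have S2_vector: "vector [a, b, c] \<in> S2 \<longleftrightarrow> a\<^sup>2 + b\<^sup>2 + c\<^sup>2 = 1" for a b c :: real
    by (simp add: norm_eq_1 inner_vec_def sum_3 power2_eq_square)
  have sum1: "(g a)\<^sup>2 + (g b)\<^sup>2 + (g c)\<^sup>2 = 1" if "a\<^sup>2 + b\<^sup>2 + c\<^sup>2 = 1" for a b c
  proof -
    let ?v = "vector [a, b, c] :: real^3"
    have v: "?v \<in> S2" using that S2_vector by blast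
    then have "?v \<bullet> ?v = 1" by (simp add: norm_eq_1)
    with expand[OF v v] g1 show ?thesis
      by (simp add: sum_3 power2_eq_square)
  qed
  \<comment> \<open>Additivity comes from comparing two unit vectors that share their last
    coordinate \<open>sqrt (1 - (a + b))\<close>. Being a square supplies the nonnegativity.\<close>
  have sq: "(g (sqrt s))\<^sup>2 = s" if "0 \<le> s" "s \<le> 1" for s
  proof (rule additive_on_unit_interval_eq_id[where h = "\<lambda>s. (g (sqrt s))\<^sup>2"])
    fix a b :: real
    assume "0 \<le> a" "0 \<le> b" "a + b \<le> 1"
    then show "(g (sqrt (a + b)))\<^sup>2 = (g (sqrt a))\<^sup>2 + (g (sqrt b))\<^sup>2"
      using sum1[of "sqrt a" "sqrt b" "sqrt (1 - (a + b))"]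
        sum1[of "sqrt (a + b)" 0 "sqrt (1 - (a + b))"] g0
      by simp
  qed (use that g1 in auto)
  have "g t = t" if "-1 \<le> t" "t \<le> 1" for t
  proof -
    \<comment> \<open>So far \<open>g\<close> is known up to sign only. Here \<open>?a\<close> and
      \<open>?c\<close> have squares with sum 1 and difference \<open>t\<close>; oddness turns the
      expansion into a difference of squares of \<open>g\<close>, where the sign is
      irrelevant.\<close>
    let ?a = "sqrt ((1 + t) / 2)" and ?c = "sqrt ((1 - t) / 2)"
    let ?v = "vector [?a, 0, ?c] :: real^3" and ?w = "vector [?a, 0, - ?c] :: real^3"
    have v: "?v \<in> S2" and w: "?w \<in> S2"
      using that by (auto simp only: S2_vector) (simp_all add: field_simps)
    have "?v \<bullet> ?w = t"
      using that by (simp add: inner_vec_def sum_3 field_simps)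
    moreover have "g (- ?c) = - g ?c"
      using odd[OF v e[of 3]] by (simp add: inner_axis)
    ultimately have "g t = (g ?a)\<^sup>2 - (g ?c)\<^sup>2"
      using expand[OF v w] g0 by (simp add: sum_3 power2_eq_square)
    also have "\<dots> = t"
      using that by (simp add: sq field_simps)
    finally show ?thesis .
  qed
  moreover have "\<bar>x \<bullet> y\<bar> \<le> 1"
    using Cauchy_Schwarz_ineq2[of x y] xy by simp
  ultimately show ?thesis
    using dep[OF xy] by (simp add: abs_le_iff)
qed

section \<open>The test field and the deformation of isotropic fields\<close>

text \<open>This is the test field for the forward implication: the covariance of its deformation is
  \<open>U x \<bullet> U y\<close>. Four equally likely outcomes suffice to build it.\<close>

lemma ex_spherical_random_field_covariance_inner:
  assumes "infinite (UNIV :: 'w set)"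
  obtains M :: "'w measure" and T where "spherical_random_field M T"
    and "covariance M T = (\<bullet>)"
proof -
  obtain A :: "'w set" where "finite A" "card A = 4"
    using infinite_arbitrarily_large[OF assms] by blast
  then obtain a b c d where A: "A = {a, b, c, d}" and
    distinct: "a \<noteq> b" "a \<noteq> c" "a \<noteq> d" "b \<noteq> c" "b \<noteq> d" "c \<noteq> d"
    by (auto simp: card_Suc_eq eval_nat_numeral)
  define M where "M = measure_pmf (pmf_of_set A)"
  \<comment> \<open>the vertices of a regular tetrahedron: their mean is zero and their covariance matrix
    is the identity\<close>
  define V :: "'w \<Rightarrow> real^3" where "V = (\<lambda>\<omega>. if \<omega> = a then vector [1, 1, 1]
    else if \<omega> = b then vector [1, -1, -1]
    else if \<omega> = c then vector [-1, 1, -1] else vector [-1, -1, 1])"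
  \<comment> \<open>The field is linear in \<open>x\<close>, so its covariance is the bilinear form
    of the covariance matrix of \<open>V\<close>.\<close>
  define T where "T = (\<lambda>x \<omega>. V \<omega> \<bullet> x)"
  have int: "(\<integral>\<omega>. f \<omega> \<partial>M) = (f a + f b + f c + f d) / 4" for f :: "'w \<Rightarrow> real"
    using distinct by (simp add: M_def integral_pmf_of_set A)
  have Vs: "V a = vector [1, 1, 1]" "V b = vector [1, -1, -1]"
    "V c = vector [-1, 1, -1]" "V d = vector [-1, -1, 1]"
    using distinct by (simp_all add: V_def)
  have cov: "covariance M T = (\<bullet>)"
    by (intro ext)
      (simp add: covariance_def int T_def Vs inner_vec_def sum_3 algebra_simps)
  have "spherical_random_field M T"
  proof (intro spherical_random_field.intro spherical_random_field_axioms.intro)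
    show "prob_space M"
      unfolding M_def by (rule prob_space_measure_pmf)
    show "T x \<in> borel_measurable M" for x
      by (simp add: M_def)
    show "integrable M (\<lambda>\<omega>. (T x \<omega>)\<^sup>2)" for x
      unfolding M_def by (rule integrable_measure_pmf_finite) (simp add: A)
    show "integral\<^sup>L M (T x) = 0" for x
      by (simp add: int T_def Vs inner_vec_def sum_3)
    show "continuous_on (S2 \<times> S2) (\<lambda>(x, y). covariance M T x y)"
      unfolding cov case_prod_beta by (intro continuous_intros)
    show "\<not> (\<lambda>(x, y). covariance M T x y) constant_on S2 \<times> S2"
    proof
      assume "(\<lambda>(x, y). covariance M T x y) constant_on S2 \<times> S2"
      then obtain k where "\<And>x y :: real^3. x \<in> S2 \<Longrightarrow> y \<in> S2 \<Longrightarrow> x \<bullet> y = k"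
        by (auto simp: constant_on_def cov)
      then have "axis (1::3) (1::real) \<bullet> axis 1 1 = axis (1::3) (1::real) \<bullet> axis 2 1"
        if "axis (1::3) (1::real) \<in> S2" "axis (2::3) (1::real) \<in> S2"
        using that by metis
      then show False
        by (simp add: inner_axis_axis)
    qed
  qed
  then show ?thesis using cov that by blast
qed

text \<open>Deforming composes the covariance with \<open>map_prod U U\<close>, a continuous map of
  \<open>S2 \<times> S2\<close> onto itself. Continuity therefore persists, surjectivity keeps the
  covariance nonconstant, and preservation of distances lets the same \<open>B\<close>
  serve.\<close>

lemma isotropic_deformed_field:
  assumes T: "isotropic_spherical_random_field M T"
    and U: "sphere_isometry U" "continuous_on S2 U"
  shows "isotropic_spherical_random_field M (deformed_field U T)"
proof -
  interpret spherical_random_field M T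
    using T by (simp add: isotropic_spherical_random_field_def)
  have img: "U ` S2 = S2" and
    dist: "\<And>x y. x \<in> S2 \<Longrightarrow> y \<in> S2 \<Longrightarrow> angular_dist (U x) (U y) = angular_dist x y"
    using U by (auto simp: sphere_isometry_def)
  have US: "U x \<in> S2" if "x \<in> S2" for x
    using img that by blast
  have cov: "covariance M (deformed_field U T) x y = covariance M T (U x) (U y)" for x y
    by (simp add: covariance_def deformed_field_def)
  have comp: "(\<lambda>(x, y). covariance M (deformed_field U T) x y) =
      (\<lambda>(x, y). covariance M T x y) \<circ> map_prod U U"
    by (auto simp: cov)
  have img2: "map_prod U U ` (S2 \<times> S2) = S2 \<times> S2"
    using img by (simp add: map_prod_surj_on)
  have "spherical_random_field M (deformed_field U T)"
  proof (unfold_locales, goal_cases)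
    case (1 x)
    then show ?case using measurable[OF US] by (simp add: deformed_field_def)
  next
    case (2 x)
    then show ?case using second_order[OF US] by (simp add: deformed_field_def)
  next
    case (3 x)
    then show ?case using zero_mean[OF US] by (simp add: deformed_field_def)
  next
    case 4
    have "continuous_on (S2 \<times> S2) (map_prod U U)"
      unfolding map_prod_def case_prod_beta
      by (intro continuous_intros continuous_on_compose2[OF U(2)]) auto
    then show ?case
      unfolding comp by (rule continuous_on_compose) (simp only: img2 continuous_covariance)
  next
    case 5
    show ?case
    proof
      assume "(\<lambda>(x, y). covariance M (deformed_field U T) x y) constant_on S2 \<times> S2"
      then have "(\<lambda>(x, y). covariance M T x y) constant_on map_prod U U ` (S2 \<times> S2)"
        unfolding comp constant_on_def by auto
      then show False
        using nonconstant_covariance by (simp only: img2)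
    qed
  qed
  moreover obtain B where
    "\<And>x y. x \<in> S2 \<Longrightarrow> y \<in> S2 \<Longrightarrow> covariance M T x y = B (angular_dist x y)"
    using T by (auto simp: isotropic_spherical_random_field_def)
  then have "\<forall>x\<in>S2. \<forall>y\<in>S2. covariance M (deformed_field U T) x y = B (angular_dist x y)"
    by (metis US dist cov)
  ultimately show ?thesis
    unfolding isotropic_spherical_random_field_def by blast
qed

theorem theorem7:
  fixes U :: "real^3 \<Rightarrow> real^3"
  assumes "infinite (UNIV :: 'w set)"
    and "\<exists>V. homeomorphism S2 S2 U V"
  shows "(\<forall>(M :: 'w measure) (T :: real^3 \<Rightarrow> 'w \<Rightarrow> real).
            isotropic_spherical_random_field M T \<longrightarrow>
            isotropic_spherical_random_field M (deformed_field U T))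
         \<longleftrightarrow> sphere_isometry U"
proof
  assume deformed: "\<forall>(M :: 'w measure) (T :: real^3 \<Rightarrow> 'w \<Rightarrow> real).
    isotropic_spherical_random_field M T \<longrightarrow>
    isotropic_spherical_random_field M (deformed_field U T)"
  have bij: "bij_betw U S2 S2"
    using assms(2) by (auto simp: homeomorphism_def bij_betw_def intro: inj_on_inverseI)
  obtain M :: "'w measure" and T where field: "spherical_random_field M T"
    and cov: "covariance M T = (\<bullet>)"
    using ex_spherical_random_field_covariance_inner[OF assms(1)] by blast
  \<comment> \<open>The Cauchy-Schwarz inequality keeps \<open>x \<bullet> y\<close> where
    \<open>cos\<close> inverts \<open>arccos\<close>; the test field is thus isotropic with
    \<open>B = cos\<close>.\<close>
  have "covariance M T x y = cos (angular_dist x y)" if "x \<in> S2" "y \<in> S2" for x y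
    using Cauchy_Schwarz_ineq2[of x y] that by (simp add: angular_dist_def cov)
  with field have "isotropic_spherical_random_field M T"
    unfolding isotropic_spherical_random_field_def by (intro conjI exI[of _ cos]) simp_all
  with deformed have "isotropic_spherical_random_field M (deformed_field U T)"
    by blast
  then obtain B where B: "\<And>x y. x \<in> S2 \<Longrightarrow> y \<in> S2 \<Longrightarrow>
      covariance M (deformed_field U T) x y = B (arccos (x \<bullet> y))"
    by (auto simp: isotropic_spherical_random_field_def angular_dist_def)
  have "covariance M (deformed_field U T) x y = U x \<bullet> U y" for x y
    using fun_cong[OF fun_cong[OF cov], of "U x" "U y"]
    by (simp add: covariance_def deformed_field_def)
  with B have "\<And>x y. x \<in> S2 \<Longrightarrow> y \<in> S2 \<Longrightarrow> U x \<bullet> U y = B (arccos (x \<bullet> y))"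
    by simp
  then have "U x \<bullet> U y = x \<bullet> y" if "x \<in> S2" "y \<in> S2" for x y
    \<comment> \<open>Isotropy of the deformed field makes \<open>U x \<bullet> U y\<close> a
      function of \<open>x \<bullet> y\<close>, namely \<open>B\<close> after
      \<open>arccos\<close>.\<close>
    by (rule inner_dependent_bij_S2_preserves_inner[OF bij, where g = "\<lambda>t. B (arccos t)"])
      (use that in auto)
  then show "sphere_isometry U"
    using bij by (simp add: sphere_isometry_def angular_dist_def bij_betw_def)
next
  assume "sphere_isometry U"
  moreover have "continuous_on S2 U"
    using assms(2) by (auto simp: homeomorphism_def)
  ultimately show "\<forall>(M :: 'w measure) (T :: real^3 \<Rightarrow> 'w \<Rightarrow> real).
    isotropic_spherical_random_field M T \<longrightarrow>
    isotropic_spherical_random_field M (deformed_field U T)"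
    using isotropic_deformed_field by blast
qed

end
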